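(* Let $X$ and $Y$ be Hermitian operators on a $d$-dimensional complex Hilbert space, $d\ge2$, with eigenvalues (counted with multiplicity) $\lambda_1\le\dots\le\lambda_d$ and $\mu_1\le\dots\le\mu_d$ respectively. For $1\le i,j\le d-1$ put $$X_i=X^2-(\lambda_i+\lambda_{i+1})X+\lambda_i\lambda_{i+1}\mathbb{1},\qquad Y_j=Y^2-(\mu_j+\mu_{j+1})Y+\mu_j\mu_{j+1}\mathbb{1},$$ and let $$\bar V=\bigcup_{i,j=1}^{d-1}W(X_i,Y_j),\qquad E=[0,\delta_X]\times[0,\delta_Y],$$ where $\delta_X=\tfrac14\left(\max_i(\lambda_{i+1}-\lambda_i)\right)^2$ and $\delta_Y=\tfrac14\left(\max_j(\mu_{j+1}-\mu_j)\right)^2$. Then the uncertainty range $V(X,Y)$ is contained in the Minkowski sum of $\bar V$ and $E$: $$V(X,Y)\subset\bar V\oplus E=\{v+e:\ v\in\bar V,\ e\in E\}.$$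
   Context: $\mathcal{M}_d=\{\rho:\rho^\dagger=\rho\ge 0,\ \mathrm{Tr}\,\rho=1\}$ is the set of density matrices (mixed states) of size $d$. For a Hermitian operator $F$ and $\rho\in\mathcal{M}_d$, $\langle F\rangle_\rho=\mathrm{Tr}(\rho F)$ and $\Delta^2F_\rho=\langle F^2\rangle_\rho-\langle F\rangle_\rho^2$. The joint numerical range of Hermitian operators $F,G$ is $W(F,G)=\{(\langle F\rangle_\rho,\langle G\rangle_\rho)\in\mathbb{R}^2:\rho\in\mathcal{M}_d\}$. The uncertainty range of $X,Y$ is $V(X,Y)=\{(\Delta^2X_\rho,\Delta^2Y_\rho)\in\mathbb{R}^2:\rho\in\mathcal{M}_d\}$. $\mathbb{1}$ is the identity operator. *)

theory Defs
  imports
    Complex_Main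
    "HOL-Library.Set_Algebras"
    "HOL-Library.Product_Plus"
    "Jordan_Normal_Form.Char_Poly"
    "Jordan_Normal_Form.Schur_Decomposition"
begin

text \<open>Operators on a \<open>d\<close>-dimensional complex Hilbert space are \<open>d \<times> d\<close> complex matrices.\<close>

definition hermitian :: "nat \<Rightarrow> complex mat \<Rightarrow> bool" where
  "hermitian d A \<longleftrightarrow> A \<in> carrier_mat d d \<and> mat_adjoint A = A"

definition mat_trace :: "complex mat \<Rightarrow> complex" where
  "mat_trace A = (\<Sum>i<dim_row A. A $$ (i, i))"

text \<open>The order on \<^typ>\<open>complex\<close> is the partial one: \<open>0 \<le> z\<close> means that \<open>z\<close> is real and
  nonnegative.\<close>

definition psd :: "nat \<Rightarrow> complex mat \<Rightarrow> bool" where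
  "psd d A \<longleftrightarrow> (\<forall>v \<in> carrier_vec d. 0 \<le> (A *\<^sub>v v) \<bullet>c v)"

definition density_matrices :: "nat \<Rightarrow> complex mat set" where
  "density_matrices d = {\<rho>. hermitian d \<rho> \<and> psd d \<rho> \<and> mat_trace \<rho> = 1}"

text \<open>The trace of a product of Hermitian matrices is real (see \<open>mat_trace_hermitian_real\<close>
  below), so taking the real part loses nothing.\<close>

definition expval :: "complex mat \<Rightarrow> complex mat \<Rightarrow> real" where
  "expval F \<rho> = Re (mat_trace (\<rho> * F))"

definition variance :: "complex mat \<Rightarrow> complex mat \<Rightarrow> real" where
  "variance F \<rho> = expval (F ^\<^sub>m 2) \<rho> - (expval F \<rho>)\<^sup>2"

definition joint_numerical_range ::
    "nat \<Rightarrow> complex mat \<Rightarrow> complex mat \<Rightarrow> (real \<times> real) set" where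
  "joint_numerical_range d F G = {(expval F \<rho>, expval G \<rho>) | \<rho>. \<rho> \<in> density_matrices d}"

definition uncertainty_range ::
    "nat \<Rightarrow> complex mat \<Rightarrow> complex mat \<Rightarrow> (real \<times> real) set" where
  "uncertainty_range d X Y = {(variance X \<rho>, variance Y \<rho>) | \<rho>. \<rho> \<in> density_matrices d}"

text \<open>\<open>l 1 \<le> \<dots> \<le> l d\<close> are the eigenvalues of \<open>A\<close>, counted with multiplicity. Values of \<open>l\<close>
  outside \<open>{1..d}\<close> are irrelevant.\<close>

definition ordered_eigenvalues :: "nat \<Rightarrow> complex mat \<Rightarrow> (nat \<Rightarrow> real) \<Rightarrow> bool" where
  "ordered_eigenvalues d A l \<longleftrightarrow>
     mono_on {1..d} l \<and> char_poly A = (\<Prod>i=1..d. [:- complex_of_real (l i), 1:])"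

definition shifted_square :: "nat \<Rightarrow> complex mat \<Rightarrow> (nat \<Rightarrow> real) \<Rightarrow> nat \<Rightarrow> complex mat" where
  "shifted_square d A l i =
     A ^\<^sub>m 2 - complex_of_real (l i + l (i + 1)) \<cdot>\<^sub>m A
       + complex_of_real (l i * l (i + 1)) \<cdot>\<^sub>m 1\<^sub>m d"

definition gap_bound :: "nat \<Rightarrow> (nat \<Rightarrow> real) \<Rightarrow> real" where
  "gap_bound d l = 1 / 4 * (MAX i\<in>{1..d - 1}. l (i + 1) - l i)\<^sup>2"

lemma mat_adjoint_index:
  assumes "A \<in> carrier_mat d d" "i < d" "j < d"
  shows "mat_adjoint A $$ (i, j) = cnj (A $$ (j, i))"
  using assms unfolding mat_adjoint_def mat_of_rows_def by simp

lemma mat_trace_hermitian_real: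
  assumes "hermitian d A" "hermitian d B"
  shows "mat_trace (A * B) \<in> \<real>"
proof -
  have c: "A \<in> carrier_mat d d" "B \<in> carrier_mat d d"
    using assms by (auto simp: hermitian_def)
  have a: "cnj (A $$ (i, j)) = A $$ (j, i)" if "i < d" "j < d" for i j
    using mat_adjoint_index[of A d j i] assms that by (simp add: hermitian_def)
  have b: "cnj (B $$ (i, j)) = B $$ (j, i)" if "i < d" "j < d" for i j
    using mat_adjoint_index[of B d j i] assms that by (simp add: hermitian_def)
  have t: "mat_trace (A * B) = (\<Sum>i<d. \<Sum>j<d. A $$ (i, j) * B $$ (j, i))"
    using c unfolding mat_trace_def
    by (auto simp: scalar_prod_def atLeast0LessThan intro!: sum.cong)
  have "cnj (mat_trace (A * B)) = (\<Sum>i<d. \<Sum>j<d. A $$ (j, i) * B $$ (i, j))"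
    unfolding t cnj_sum by (intro sum.cong refl) (simp add: a b)
  also have "\<dots> = mat_trace (A * B)"
    unfolding t by (rule sum.swap)
  finally show ?thesis
    by (metis Reals_cnj_iff)
qed

end

(* For a state rho put x = <X>, so lam_1 <= x <= lam_d, since in an eigenbasis of X the value x is a
   convex combination of eigenvalues. Choose i with lam_i <= x <= lam_(i+1). Then
   Var X = <X_i> + (x - lam_i) (lam_(i+1) - x), and the last product lies between 0 and
   (lam_(i+1) - lam_i)^2 / 4. The same holds for Y in the same state. *)

theory Submission
  imports Defs "Jordan_Normal_Form.Spectral_Radius"
begin

section \<open>Adjoints and traces\<close>

lemma dim_mat_adjoint [simp]:
  "dim_row (mat_adjoint A) = dim_col A" "dim_col (mat_adjoint A) = dim_row A"
  by (simp_all add: mat_adjoint_def)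

lemma mat_adjoint_carrier [simp]:
  "A \<in> carrier_mat n m \<Longrightarrow> mat_adjoint A \<in> carrier_mat m n"
  by (intro carrier_matI) auto

lemma index_mat_adjoint [simp]:
  fixes A :: "complex mat"
  assumes "i < dim_col A" "j < dim_row A"
  shows "mat_adjoint A $$ (i, j) = cnj (A $$ (j, i))"
  using assms unfolding mat_adjoint_def mat_of_rows_def by simp

lemma mat_adjoint_adjoint [simp]: "mat_adjoint (mat_adjoint A) = (A :: complex mat)"
  by (rule eq_matI) auto

lemma mat_adjoint_mult:
  fixes A B :: "complex mat"
  assumes "A \<in> carrier_mat n m" "B \<in> carrier_mat m k"
  shows "mat_adjoint (A * B) = mat_adjoint B * mat_adjoint A"
  using assms by (intro eq_matI) (auto simp: scalar_prod_def intro!: sum.cong)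

lemma mat_adjoint_four_block:
  fixes A B C D :: "complex mat"
  assumes "A \<in> carrier_mat n1 m1" "B \<in> carrier_mat n1 m2"
    and "C \<in> carrier_mat n2 m1" "D \<in> carrier_mat n2 m2"
  shows "mat_adjoint (four_block_mat A B C D) =
    four_block_mat (mat_adjoint A) (mat_adjoint C) (mat_adjoint B) (mat_adjoint D)"
  using assms by (intro eq_matI) auto

lemma mat_adjoint_zero [simp]: "mat_adjoint (0\<^sub>m n m :: complex mat) = 0\<^sub>m m n"
  by (rule eq_matI) auto

lemma mat_adjoint_one [simp]: "mat_adjoint (1\<^sub>m n :: complex mat) = 1\<^sub>m n"
  by (rule eq_matI) auto

section \<open>Traces: double-sum form, cyclicity and linearity\<close>

lemma mat_trace_mult:
  assumes "A \<in> carrier_mat n m" "B \<in> carrier_mat m n"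
  shows "mat_trace (A * B) = (\<Sum>i<n. \<Sum>j<m. A $$ (i, j) * B $$ (j, i))"
  using assms unfolding mat_trace_def
  by (auto simp: scalar_prod_def atLeast0LessThan intro!: sum.cong)

lemma mat_trace_comm:
  assumes "A \<in> carrier_mat n m" "B \<in> carrier_mat m n"
  shows "mat_trace (A * B) = mat_trace (B * A)"
  unfolding mat_trace_mult[OF assms] mat_trace_mult[OF assms(2,1)]
  by (subst sum.swap) (simp add: mult.commute)

lemma mat_trace_add:
  assumes "A \<in> carrier_mat n n" "B \<in> carrier_mat n n"
  shows "mat_trace (A + B) = mat_trace A + mat_trace B"
  using assms by (auto simp: mat_trace_def sum.distrib)

lemma mat_trace_minus:
  assumes "A \<in> carrier_mat n n" "B \<in> carrier_mat n n"
  shows "mat_trace (A - B) = mat_trace A - mat_trace B"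
  using assms by (auto simp: mat_trace_def sum_subtractf)

lemma mat_trace_smult:
  assumes "A \<in> carrier_mat n n"
  shows "mat_trace (c \<cdot>\<^sub>m A) = c * mat_trace A"
  using assms by (auto simp: mat_trace_def sum_distrib_left)


section \<open>Unitary diagonalization of Hermitian matrices\<close>

text \<open>Complete \<open>v\<close> to a basis, orthogonalise by Gram-Schmidt, which keeps the
  first vector, and normalise the columns. The scalar \<open>c\<close> may stay unspecified, because
  the intended \<open>v\<close> is an eigenvector and any nonzero multiple of it serves as
  well.\<close>

lemma unitary_with_first_column:
  fixes v :: "complex vec"
  assumes v: "v \<in> carrier_vec n" and v0: "v \<noteq> 0\<^sub>v n"
  obtains U c where "U \<in> carrier_mat n n" "mat_adjoint U * U = 1\<^sub>m n" "col U 0 = c \<cdot>\<^sub>v v"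
proof -
  interpret cof_vec_space n "TYPE(complex)" .
  define b where "b = basis_completion v"
  define ws where "ws = gram_schmidt n b"
  from basis_completion[OF v v0, folded b_def]
  have dist_b: "distinct b" and indep: "\<not> lin_dep (set b)" and b: "set b \<subseteq> carrier_vec n"
    and hdb: "hd b = v" and len_b: "length b = n" by auto
  have n: "n > 0"
    using v v0 by (cases n) auto
  from hdb len_b n obtain vs where bv: "b = v # vs" by (cases b) auto
  from gram_schmidt_result[OF b dist_b indep refl, folded ws_def]
  have ws: "set ws \<subseteq> carrier_vec n" "corthogonal ws" "length ws = n"
    by (auto simp: len_b)
  from gram_schmidt_hd[OF v, of vs, folded bv] have "hd ws = v" unfolding ws_def .
  then have ws0: "ws ! 0 = v"
    using ws(3) n by (metis hd_conv_nth length_0_conv less_numeral_extra(3))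
  \<comment> \<open>\<open>a i\<close> is the squared norm of the i-th orthogonal vector, a complex
    number that has to be shown real and positive; \<open>s i\<close> is the reciprocal of the
    norm.\<close>
  define a where "a = (\<lambda>i. ws ! i \<bullet>c ws ! i)"
  define s where "s = (\<lambda>i. complex_of_real (1 / sqrt (Re (a i))))"
  have wsc: "ws ! i \<in> carrier_vec n" if "i < n" for i
    using ws that by auto
  have a_pos: "a i = of_real (Re (a i))" "Re (a i) > 0" if "i < n" for i
  proof -
    have "a i \<ge> 0" unfolding a_def by (rule conjugate_square_ge_0_vec)
    moreover have "a i \<noteq> 0"
      unfolding a_def using corthogonalD[OF ws(2), of i i] ws(3) that by auto
    ultimately show "a i = of_real (Re (a i))" "Re (a i) > 0"
      by (auto simp: less_eq_complex_def complex_eq_iff)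
  qed
  define U where "U = mat n n (\<lambda>(i, j). s j * ws ! j $ i)"
  have U: "U \<in> carrier_mat n n" by (simp add: U_def)
  have "mat_adjoint U * U = 1\<^sub>m n"
  proof (rule eq_matI)
    fix i j assume "i < dim_row (1\<^sub>m n)" "j < dim_col (1\<^sub>m n :: complex mat)"
    then have ij: "i < n" "j < n" by auto
    have "(mat_adjoint U * U) $$ (i, j) = (\<Sum>k<n. cnj (s i) * cnj (ws ! i $ k) * (s j * ws ! j $ k))"
      using ij U by (simp add: scalar_prod_def atLeast0LessThan) (simp add: U_def)
    also have "\<dots> = s i * s j * (ws ! j \<bullet>c ws ! i)"
      using wsc[OF ij(1)] wsc[OF ij(2)]
      by (simp add: scalar_prod_def atLeast0LessThan sum_distrib_left s_def ac_simps)
    also have "\<dots> = 1\<^sub>m n $$ (i, j)"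
    proof (cases "i = j")
      case True
      \<comment> \<open>Only the bare factor \<open>a i\<close>, the third occurrence, is replaced
        by its real part; the two under the square roots already have that form.\<close>
      have "s i * s i * a i = of_real ((1 / sqrt (Re (a i)))\<^sup>2 * Re (a i))"
        unfolding s_def by (subst (3) a_pos(1)[OF ij(1)]) (simp only: of_real_mult power2_eq_square)
      also have "(1 / sqrt (Re (a i)))\<^sup>2 * Re (a i) = 1"
        using a_pos(2)[OF ij(1)] by (simp add: power_divide)
      finally show ?thesis using True ij by (simp add: a_def)
    next
      case False
      then show ?thesis
        using corthogonalD[OF ws(2), of j i] ws(3) ij by simp
    qed
    finally show "(mat_adjoint U * U) $$ (i, j) = 1\<^sub>m n $$ (i, j)" .
  qed (use U in auto)
  moreover have "col U 0 = s 0 \<cdot>\<^sub>v v"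
    using v n by (intro eq_vecI) (auto simp: U_def ws0)
  ultimately show ?thesis using U that by blast
qed

text \<open>The spectral theorem by deflation: conjugating with a unitary whose first column is an
  eigenvector splits off a 1 by 1 block, and the remaining block is Hermitian of size one
  less.\<close>

theorem hermitian_unitary_diagonalization:
  assumes "hermitian n A"
  obtains U D where "U \<in> carrier_mat n n" "D \<in> carrier_mat n n" "mat_adjoint U * U = 1\<^sub>m n"
    "diagonal_mat D" "A = U * D * mat_adjoint U"
proof -
  have "\<exists>U D. U \<in> carrier_mat n n \<and> D \<in> carrier_mat n n \<and> mat_adjoint U * U = 1\<^sub>m n \<and>
    diagonal_mat D \<and> A = U * D * mat_adjoint U"
    using assms
  proof (induction n arbitrary: A)
    case 0
    then have "A \<in> carrier_mat 0 0" by (simp add: hermitian_def)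
    then show ?case
      by (intro exI[of _ "1\<^sub>m 0"] exI[of _ A]) (auto simp: diagonal_mat_def intro!: eq_matI)
  next
    case (Suc n)
    then have A: "A \<in> carrier_mat (Suc n) (Suc n)" and Ah: "mat_adjoint A = A"
      by (auto simp: hermitian_def)
    note assoc = assoc_mult_mat[of _ "Suc n" "Suc n" _ "Suc n" _ "Suc n"]
      and carrier = mult_carrier_mat[of _ "Suc n" "Suc n" _ "Suc n"]
      and adjoint = mat_adjoint_mult[of _ "Suc n" "Suc n" _ "Suc n"]
    \<comment> \<open>Here the complex field matters: in positive dimension the characteristic
      polynomial has a root.\<close>
    obtain e v where v: "v \<in> carrier_vec (Suc n)" "v \<noteq> 0\<^sub>v (Suc n)" and Av: "A *\<^sub>v v = e \<cdot>\<^sub>v v"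
      using spectrum_non_empty[OF A] A
      by (auto simp: spectrum_def eigenvalue_def eigenvector_def)
    obtain W c where W: "W \<in> carrier_mat (Suc n) (Suc n)" and WW: "mat_adjoint W * W = 1\<^sub>m (Suc n)"
      and W0: "col W 0 = c \<cdot>\<^sub>v v"
      using unitary_with_first_column[OF v] .
    have WW': "W * mat_adjoint W = 1\<^sub>m (Suc n)"
      using mat_mult_left_right_inverse[OF _ W WW] W by simp
    define B where "B = mat_adjoint W * A * W"
    have B: "B \<in> carrier_mat (Suc n) (Suc n)" using A W by (simp add: B_def carrier)
    have Bh: "mat_adjoint B = B"
    proof -
      have "mat_adjoint B = mat_adjoint W * (mat_adjoint A * W)"
        unfolding B_def using A W
        by (simp add: adjoint carrier)
      then show ?thesis
        unfolding B_def Ah using A W by (simp add: assoc)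
    qed
    have cnj_B: "cnj (B $$ (i, j)) = B $$ (j, i)" if "i < Suc n" "j < Suc n" for i j
      using index_mat_adjoint[of j B i] B that by (simp add: Bh)
    \<comment> \<open>The first column of \<open>W\<close> is still an eigenvector for
      \<open>e\<close>, so the first column of \<open>B\<close> is \<open>e\<close> times the first
      column of \<open>mat_adjoint W * W\<close>, the identity.\<close>
    have B_col: "B $$ (i, 0) = (if i = 0 then e else 0)" if i: "i < Suc n" for i
    proof -
      have "B $$ (i, 0) = row (mat_adjoint W) i \<bullet> (A *\<^sub>v col W 0)"
        using A W i by (simp add: B_def assoc carrier mult_mat_vec_def)
      also have "A *\<^sub>v col W 0 = e \<cdot>\<^sub>v col W 0"
        unfolding W0 using A v by (simp add: mult_mat_vec Av smult_smult_assoc mult.commute)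
      also have "row (mat_adjoint W) i \<bullet> (e \<cdot>\<^sub>v col W 0) = e * (mat_adjoint W * W) $$ (i, 0)"
        using W i by simp
      finally show ?thesis using i by (simp add: WW)
    qed
    define B3 where "B3 = mat n n (\<lambda>(i, j). B $$ (Suc i, Suc j))"
    define E where "E = mat 1 1 (\<lambda>_. e)"
    have B3: "B3 \<in> carrier_mat n n" and E: "E \<in> carrier_mat 1 1"
      by (auto simp: B3_def E_def)
    have B_block: "B = four_block_mat E (0\<^sub>m 1 n) (0\<^sub>m n 1) B3"
    \<comment> \<open>The first row vanishes off the diagonal because it is the conjugate of the
      first column.\<close>
    proof (rule eq_matI)
      fix i j assume "i < dim_row (four_block_mat E (0\<^sub>m 1 n) (0\<^sub>m n 1) B3)"
        and "j < dim_col (four_block_mat E (0\<^sub>m 1 n) (0\<^sub>m n 1) B3)"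
      then have ij: "i < Suc n" "j < Suc n" using E B3 by auto
      show "B $$ (i, j) = four_block_mat E (0\<^sub>m 1 n) (0\<^sub>m n 1) B3 $$ (i, j)"
        using ij B_col[OF ij(1)] B_col[OF ij(2)] cnj_B[OF ij(2,1)]
        by (cases i; cases j) (auto simp: E_def B3_def)
    qed (use B E B3 in auto)
    have "hermitian n B3"
      unfolding hermitian_def using B3 cnj_B
      by (auto intro!: eq_matI) (simp add: B3_def)
    from Suc.IH[OF this] obtain U D where U: "U \<in> carrier_mat n n" and D: "D \<in> carrier_mat n n"
      and UU: "mat_adjoint U * U = 1\<^sub>m n" and dD: "diagonal_mat D" and B3_eq: "B3 = U * D * mat_adjoint U"
      by blast
    \<comment> \<open>The diagonalisation of the smaller block is extended by the identity on the
      split-off coordinate; the eigenbasis of \<open>A\<close> is then given by the columns of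
      \<open>W * V\<close>.\<close>
    define V where "V = four_block_mat (1\<^sub>m 1) (0\<^sub>m 1 n) (0\<^sub>m n 1) U"
    define F where "F = four_block_mat E (0\<^sub>m 1 n) (0\<^sub>m n 1) D"
    have V: "V \<in> carrier_mat (Suc n) (Suc n)" and F: "F \<in> carrier_mat (Suc n) (Suc n)"
      using U D E by (auto simp: V_def F_def)
    have V_adj: "mat_adjoint V = four_block_mat (1\<^sub>m 1) (0\<^sub>m 1 n) (0\<^sub>m n 1) (mat_adjoint U)"
      unfolding V_def using U by (subst mat_adjoint_four_block[of _ 1 1 _ n _ n]) auto
    have VV: "mat_adjoint V * V = 1\<^sub>m (Suc n)"
      unfolding V_adj unfolding V_def
      using U by (subst mult_four_block_mat[of _ 1 1 _ n _ n _ _ 1 _ n]) (auto simp: UU intro!: eq_matI)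
    have "V * F = four_block_mat E (0\<^sub>m 1 n) (0\<^sub>m n 1) (U * D)"
      unfolding V_def F_def
      using U D E by (subst mult_four_block_mat[of _ 1 1 _ n _ n _ _ 1 _ n]) auto
    then have VFV: "V * F * mat_adjoint V = B"
      unfolding V_adj B_block B3_eq
      using U D E by (simp, subst mult_four_block_mat[of _ 1 1 _ n _ n _ _ 1 _ n]) auto
    have "W * B * mat_adjoint W = (W * mat_adjoint W) * A * (W * mat_adjoint W)"
      unfolding B_def using A W by (simp add: assoc carrier)
    then have "A = W * (V * F * mat_adjoint V) * mat_adjoint W"
      using A by (simp add: WW' VFV)
    also have "\<dots> = (W * V) * F * mat_adjoint (W * V)"
      using W V F by (simp add: adjoint assoc carrier)
    finally have A_eq: "A = (W * V) * F * mat_adjoint (W * V)" .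
    have "mat_adjoint (W * V) * (W * V) = mat_adjoint V * ((mat_adjoint W * W) * V)"
      using W V by (simp add: adjoint assoc carrier)
    then have "mat_adjoint (W * V) * (W * V) = 1\<^sub>m (Suc n)"
      using V by (simp add: WW VV)
    moreover have "diagonal_mat F"
      using dD D E unfolding diagonal_mat_def F_def by (auto simp: less_Suc_eq_0_disj) blast
    ultimately show ?case
      using A_eq W V F by (intro exI[of _ "W * V"] exI[of _ F]) auto
  qed
  then show ?thesis using that by blast
qed


section \<open>Expectation values\<close>

text \<open>In an orthonormal eigenbasis of \<open>X\<close> the diagonal entries of the state are
  nonnegative and sum to 1; they are the weights with which the eigenvalues are averaged.\<close>

lemma expval_between_eigenvalues:
  assumes X: "hermitian d X" and ev: "ordered_eigenvalues d X l" and \<rho>: "\<rho> \<in> density_matrices d"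
  shows "l 1 \<le> expval X \<rho>" "expval X \<rho> \<le> l d"
proof -
  note assoc = assoc_mult_mat[of _ d d _ d _ d] and carrier = mult_carrier_mat[of _ d d _ d]
  from \<rho> have \<rho>c: "\<rho> \<in> carrier_mat d d" and \<rho>psd: "psd d \<rho>" and tr: "mat_trace \<rho> = 1"
    by (auto simp: density_matrices_def hermitian_def)
  obtain U D where U: "U \<in> carrier_mat d d" and D: "D \<in> carrier_mat d d"
    and UU: "mat_adjoint U * U = 1\<^sub>m d" and dD: "diagonal_mat D" and X_eq: "X = U * D * mat_adjoint U"
    using hermitian_unitary_diagonalization[OF X] .
  have UU': "U * mat_adjoint U = 1\<^sub>m d"
    using mat_mult_left_right_inverse[OF _ U UU] U by simp
  have Xc: "X \<in> carrier_mat d d" using X by (simp add: hermitian_def)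
  have "similar_mat X D"
    unfolding similar_mat_def
    using similar_mat_witI[OF UU' UU X_eq Xc D U] U by auto
  then have "char_poly D = (\<Prod>i=1..d. [:- complex_of_real (l i), 1:])"
    using char_poly_similar ev by (metis ordered_eigenvalues_def)
  \<comment> \<open>The given eigenvalues enter only through the characteristic polynomial.
    Similarity preserves it, so each diagonal entry of \<open>D\<close> is a root of the product
    over \<open>l\<close> and hence equals some \<open>l i\<close>.\<close>
  moreover have "poly (char_poly D) (D $$ (k, k)) = 0" if "k < d" for k
  proof -
    have "char_poly D = (\<Prod>a\<leftarrow>diag_mat D. [:- a, 1:])"
      using D dD by (intro char_poly_upper_triangular[OF D]) (auto simp: diagonal_mat_def)
    moreover have "D $$ (k, k) \<in> set (diag_mat D)"
      using D that by (auto simp: diag_mat_def)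
    ultimately show ?thesis
      by (auto simp: poly_prod_list o_def image_iff intro!: bexI[of _ "D $$ (k, k)"])
  qed
  ultimately have "\<exists>i\<in>{1..d}. D $$ (k, k) = of_real (l i)" if "k < d" for k
    using that by (fastforce simp: poly_prod)
  \<comment> \<open>Monotonicity of \<open>l\<close> puts every such value between
    \<open>l 1\<close> and \<open>l d\<close>.\<close>
  then have "\<exists>r. D $$ (k, k) = of_real r \<and> l 1 \<le> r \<and> r \<le> l d" if "k < d" for k
    using that ev unfolding ordered_eigenvalues_def mono_on_def by fastforce
  then obtain r where r: "\<And>k. k < d \<Longrightarrow> D $$ (k, k) = of_real (r k)"
    and r_bounds: "\<And>k. k < d \<Longrightarrow> l 1 \<le> r k" "\<And>k. k < d \<Longrightarrow> r k \<le> l d"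
    by metis
  \<comment> \<open>\<open>P\<close> is the state written in the eigenbasis, and \<open>p k\<close>
    is the probability of the k-th eigenvector.\<close>
  define P where "P = mat_adjoint U * \<rho> * U"
  define p where "p = (\<lambda>k. Re (P $$ (k, k)))"
  have P: "P \<in> carrier_mat d d"
    using U \<rho>c by (simp add: P_def carrier)
  have p_nonneg: "p k \<ge> 0" if k: "k < d" for k
  proof -
    \<comment> \<open>The entry is the quadratic form of \<open>\<rho>\<close> at the k-th column of
      \<open>U\<close>, so positivity of \<open>\<rho>\<close> applies.\<close>
    have "P $$ (k, k) = row (mat_adjoint U) k \<bullet> (\<rho> *\<^sub>v col U k)"
      using U \<rho>c k by (simp add: P_def assoc carrier mult_mat_vec_def)
    also have "\<dots> = (\<rho> *\<^sub>v col U k) \<bullet>c col U k"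
      using U \<rho>c k by (auto simp: scalar_prod_def mult.commute intro!: sum.cong)
    finally show ?thesis
      using \<rho>psd U k by (auto simp: psd_def p_def less_eq_complex_def)
  qed
  have "mat_trace P = mat_trace (U * (mat_adjoint U * \<rho>))"
    unfolding P_def using U \<rho>c by (intro mat_trace_comm[of _ d d]) (simp_all add: carrier)
  also have "U * (mat_adjoint U * \<rho>) = (U * mat_adjoint U) * \<rho>"
    using U \<rho>c by (simp add: assoc carrier)
  finally have "mat_trace P = 1" using \<rho>c tr by (simp add: UU')
  then have p_sum: "(\<Sum>k<d. p k) = 1"
    using P by (auto simp: mat_trace_def p_def complex_eq_iff)
  \<comment> \<open>Cyclicity of the trace moves the unitaries onto the state; as \<open>D\<close>
    is diagonal, only the diagonal of \<open>P\<close> survives.\<close>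
  have "mat_trace (\<rho> * X) = mat_trace (\<rho> * U * D * mat_adjoint U)"
    unfolding X_eq using U D \<rho>c by (simp add: assoc carrier)
  also have "\<dots> = mat_trace (mat_adjoint U * (\<rho> * U * D))"
    using U D \<rho>c by (intro mat_trace_comm[of _ d d]) (simp_all add: carrier)
  also have "mat_adjoint U * (\<rho> * U * D) = P * D"
    unfolding P_def using U D \<rho>c by (simp add: assoc carrier)
  also have "mat_trace (P * D) = (\<Sum>i<d. \<Sum>j<d. P $$ (i, j) * D $$ (j, i))"
    using P D by (rule mat_trace_mult)
  also have "\<dots> = (\<Sum>i<d. \<Sum>j<d. if j = i then P $$ (i, i) * of_real (r i) else 0)"
    using dD D by (intro sum.cong refl) (auto simp: r diagonal_mat_def)
  also have "\<dots> = (\<Sum>i<d. P $$ (i, i) * of_real (r i))"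
    by (intro sum.cong refl) simp
  finally have E: "expval X \<rho> = (\<Sum>k<d. p k * r k)"
    by (simp add: expval_def p_def)
  \<comment> \<open>Each constant bound is written as its own weighted average, so that the sums can
    be compared termwise.\<close>
  have bound: "(\<Sum>k<d. p k * c) = c" for c
    by (simp add: p_sum flip: sum_distrib_right)
  have "(\<Sum>k<d. p k * l 1) \<le> expval X \<rho>" "expval X \<rho> \<le> (\<Sum>k<d. p k * l d)"
    unfolding E by (intro sum_mono mult_left_mono; simp add: p_nonneg r_bounds[simplified])+
  then show "l 1 \<le> expval X \<rho>" "expval X \<rho> \<le> l d"
    by (simp_all add: bound)
qed

section \<open>The variance of a single operator\<close>

text \<open>\<open>shifted_square\<close> is the expanded product of \<open>X - l i\<close> and
  \<open>X - l (i + 1)\<close>. Expectation is linear and the state has trace 1, so replacing the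
  mean of the square by the variance plus the squared mean leaves exactly the scalar product on the
  right.\<close>

lemma expval_shifted_square:
  assumes X: "X \<in> carrier_mat d d" and \<rho>: "\<rho> \<in> density_matrices d"
  shows "expval (shifted_square d X l i) \<rho> =
    variance X \<rho> - (expval X \<rho> - l i) * (l (i + 1) - expval X \<rho>)"
proof -
  from \<rho> have \<rho>c: "\<rho> \<in> carrier_mat d d" and tr: "mat_trace \<rho> = 1"
    by (auto simp: density_matrices_def hermitian_def)
  let ?s = "complex_of_real (l i + l (i + 1))" and ?q = "complex_of_real (l i * l (i + 1))"
  have "\<rho> * shifted_square d X l i = \<rho> * X ^\<^sub>m 2 - ?s \<cdot>\<^sub>m (\<rho> * X) + ?q \<cdot>\<^sub>m \<rho>"
    unfolding shifted_square_def using X \<rho>c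
    by (simp add: mult_add_distrib_mat[of _ d d _ d] mult_minus_distrib_mat[of _ d d _ d]
        mult_smult_distrib[of _ d d _ d] minus_carrier_mat[of _ d d])
  then have "mat_trace (\<rho> * shifted_square d X l i) =
      mat_trace (\<rho> * X ^\<^sub>m 2) - ?s * mat_trace (\<rho> * X) + ?q"
    using X \<rho>c tr
    by (simp add: mat_trace_add[of _ d] mat_trace_minus[of _ d] mat_trace_smult[of _ d]
        minus_carrier_mat[of _ d d] mult_carrier_mat[of _ d d])
  \<comment> \<open>The coefficients are real, so taking real parts commutes with multiplying by
    them.\<close>
  then have "expval (shifted_square d X l i) \<rho> =
      expval (X ^\<^sub>m 2) \<rho> - (l i + l (i + 1)) * expval X \<rho> + l i * l (i + 1)"
    by (simp add: expval_def)
  then show ?thesis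
    by (simp add: variance_def power2_eq_square algebra_simps)
qed

text \<open>A discrete intermediate value argument, by induction on the last index starting at 2:
  either \<open>x\<close> is already below \<open>l n\<close>, or the newly added step from
  \<open>n\<close> to \<open>n + 1\<close> contains it.\<close>

lemma exists_bracketing_step:
  fixes l :: "nat \<Rightarrow> 'a :: linorder"
  assumes "d \<ge> 2" "l 1 \<le> x" "x \<le> l d"
  shows "\<exists>i\<in>{1..d - 1}. l i \<le> x \<and> x \<le> l (i + 1)"
  using assms
proof (induction d rule: dec_induct)
  case base
  then show ?case by (auto simp: numeral_2_eq_2)
next
  case (step n)
  show ?case
  proof (cases "x \<le> l n")
    case True
    then show ?thesis using step by fastforce
  next
    case False
    then show ?thesis using step by (intro bexI[of _ n]) auto
  qed
qed

text \<open>Two nonnegative numbers with sum \<open>l (i + 1) - l i\<close> have product at most a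
  quarter of the squared sum, and this gap is at most the largest one.\<close>

lemma product_le_gap_bound:
  assumes i: "i \<in> {1..d - 1}" and x: "l i \<le> x" "x \<le> l (i + 1)"
  shows "(x - l i) * (l (i + 1) - x) \<in> {0..gap_bound d l}"
proof -
  have "l (i + 1) - l i \<le> (MAX i\<in>{1..d - 1}. l (i + 1) - l i)"
    using i by (intro Max_ge) auto
  \<comment> \<open>Squaring preserves the inequality because the gap is nonnegative,
    \<open>x\<close> lying between its ends.\<close>
  then have "(l (i + 1) - l i)\<^sup>2 \<le> (MAX i\<in>{1..d - 1}. l (i + 1) - l i)\<^sup>2"
    using x by (intro power_mono) auto
  \<comment> \<open>This square equals the squared gap minus four times the product.\<close>
  moreover have "0 \<le> ((x - l i) - (l (i + 1) - x))\<^sup>2" by simp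
  ultimately have "(x - l i) * (l (i + 1) - x) \<le> gap_bound d l"
    unfolding gap_bound_def by (simp add: power2_eq_square algebra_simps)
  with x show ?thesis by simp
qed

text \<open>The claim for one coordinate: \<open>i\<close> brackets the mean and \<open>e\<close> is
  the product of its distances to the two neighbouring eigenvalues. It is stated for a fixed state
  so that it can be applied to both operators at once.\<close>

lemma variance_decomposition:
  assumes "d \<ge> 2" "hermitian d X" "ordered_eigenvalues d X l" "\<rho> \<in> density_matrices d"
  obtains i e where "i \<in> {1..d - 1}" "e \<in> {0..gap_bound d l}"
    "variance X \<rho> = expval (shifted_square d X l i) \<rho> + e"
proof -
  obtain i where i: "i \<in> {1..d - 1}" "l i \<le> expval X \<rho>" "expval X \<rho> \<le> l (i + 1)"
    using exists_bracketing_step[OF assms(1) expval_between_eigenvalues[OF assms(2-4)]] by blast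
  have "X \<in> carrier_mat d d" using assms(2) by (simp add: hermitian_def)
  from expval_shifted_square[OF this assms(4), of l i] show ?thesis
    using that[OF i(1) product_le_gap_bound[OF i]] by simp
qed

theorem mainTheorem4:
  fixes d :: nat and X Y :: "complex mat" and lam mu :: "nat \<Rightarrow> real"
  assumes "d \<ge> 2"
    and "hermitian d X" and "hermitian d Y"
    and "ordered_eigenvalues d X lam" and "ordered_eigenvalues d Y mu"
  shows "uncertainty_range d X Y \<subseteq>
    (\<Union>i\<in>{1..d - 1}. \<Union>j\<in>{1..d - 1}.
        joint_numerical_range d (shifted_square d X lam i) (shifted_square d Y mu j))
    + {0..gap_bound d lam} \<times> {0..gap_bound d mu}"
proof
  fix z assume "z \<in> uncertainty_range d X Y"
  then obtain \<rho> where \<rho>: "\<rho> \<in> density_matrices d" and z: "z = (variance X \<rho>, variance Y \<rho>)"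
    by (auto simp: uncertainty_range_def)
  obtain i e where i: "i \<in> {1..d - 1}" "e \<in> {0..gap_bound d lam}"
    "variance X \<rho> = expval (shifted_square d X lam i) \<rho> + e"
    using variance_decomposition[OF assms(1,2,4) \<rho>] .
  obtain j f where j: "j \<in> {1..d - 1}" "f \<in> {0..gap_bound d mu}"
    "variance Y \<rho> = expval (shifted_square d Y mu j) \<rho> + f"
    using variance_decomposition[OF assms(1,3,5) \<rho>] .
  \<comment> \<open>The indices \<open>i\<close> and \<open>j\<close> are chosen independently, but
    the same state gives both expectations, which is what membership in a joint numerical range
    requires.\<close>
  have "(expval (shifted_square d X lam i) \<rho>, expval (shifted_square d Y mu j) \<rho>)
      \<in> joint_numerical_range d (shifted_square d X lam i) (shifted_square d Y mu j)"
    using \<rho> by (auto simp: joint_numerical_range_def)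
  with i(1,2) j(1,2) have "(expval (shifted_square d X lam i) \<rho>, expval (shifted_square d Y mu j) \<rho>) + (e, f)
      \<in> (\<Union>i\<in>{1..d - 1}. \<Union>j\<in>{1..d - 1}.
        joint_numerical_range d (shifted_square d X lam i) (shifted_square d Y mu j))
    + {0..gap_bound d lam} \<times> {0..gap_bound d mu}"
    by (blast intro: set_plus_intro)
  then show "z \<in> (\<Union>i\<in>{1..d - 1}. \<Union>j\<in>{1..d - 1}.
        joint_numerical_range d (shifted_square d X lam i) (shifted_square d Y mu j))
    + {0..gap_bound d lam} \<times> {0..gap_bound d mu}"
    by (simp add: z i(3) j(3))
qed

end
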